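(* There is an almost sure event $\mathcal A\subseteq 2^\omega$ such that if $X\in\mathcal A$ then $X$ has an infinite subset $Y\subseteq X$ such that no element of $\mathcal A$ is Turing reducible to $Y$.
   Context: $\omega=\{0,1,2,\ldots\}$. Sets $X\subseteq\omega$ are identified with their characteristic sequences in $2^\omega$. An event is a measurable subset of $2^\omega$ (the power set of $\omega$); it is almost sure if it has probability $1$ under the fair-coin (Lebesgue) measure on $2^\omega$. *)

theory Defs
  imports "HOL-Probability.Probability"
begin

text \<open>
  Turing reducibility is given by the partial recursive functions relative to an oracle: the
  closure of the initial functions and the characteristic function of the oracle under
  composition, primitive recursion and unbounded search. Argument tuples are lists; a program
  applied to a tuple of the wrong length simply has no value (\<open>Zero\<close> and \<open>Proj i\<close> stand for the
  constant and projection functions of every admissible arity at once).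
\<close>

datatype recf =
    Zero
  | Succ
  | Proj nat
  | Oracle
  | Comp recf "recf list"
  | PrimRec recf recf
  | Search recf

text \<open>\<open>computes Y p xs v\<close>: program \<open>p\<close> with oracle \<open>Y\<close> halts on input \<open>xs\<close> with output \<open>v\<close>.\<close>

inductive computes :: "nat set \<Rightarrow> recf \<Rightarrow> nat list \<Rightarrow> nat \<Rightarrow> bool" for Y :: "nat set" where
  Zero: "computes Y Zero xs 0"
| Succ: "computes Y Succ [x] (Suc x)"
| Proj: "i < length xs \<Longrightarrow> computes Y (Proj i) xs (xs ! i)"
| Oracle: "computes Y Oracle [x] (of_bool (x \<in> Y))"
| Comp: "list_all2 (\<lambda>g v. computes Y g xs v) gs vs \<Longrightarrow> computes Y f vs w \<Longrightarrow>
    computes Y (Comp f gs) xs w"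
| PrimRec_0: "computes Y f xs v \<Longrightarrow> computes Y (PrimRec f g) (0 # xs) v"
| PrimRec_Suc: "computes Y (PrimRec f g) (n # xs) r \<Longrightarrow> computes Y g (n # r # xs) v \<Longrightarrow>
    computes Y (PrimRec f g) (Suc n # xs) v"
| Search: "computes Y f (n # xs) 0 \<Longrightarrow> (\<forall>m<n. \<exists>r. computes Y f (m # xs) (Suc r)) \<Longrightarrow>
    computes Y (Search f) xs n"

definition turing_reducible :: "nat set \<Rightarrow> nat set \<Rightarrow> bool" where
  "turing_reducible X Y \<longleftrightarrow> (\<exists>p. \<forall>n. computes Y p [n] (of_bool (n \<in> X)))"

definition char_seq :: "nat set \<Rightarrow> nat \<Rightarrow> bool" where
  "char_seq X = (\<lambda>n. n \<in> X)"

text \<open>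
  The fair-coin measure on Cantor space, on the product (Borel) \<open>\<sigma>\<close>-algebra. It is not
  completed, so an event of this measure space is in particular Lebesgue measurable.
\<close>

definition fair_coin :: "(nat \<Rightarrow> bool) measure" where
  "fair_coin = PiM UNIV (\<lambda>_. measure_pmf (bernoulli_pmf (1 / 2)))"

end

(*
  Consider trees of finite sequences of numbers with infinite successor sets everywhere. For
  an oracle read off from a branch, whether a given program outputs 1 on a given input is an open
  condition on the branch, so it can be decided by thinning the tree above each node (pure decision
  for Laver-like trees), and a fusion argument decides it at level n for the first n programs and
  any prescribed finite number of inputs. Now cut the resulting tree down to a finitely branching
  one whose successor sets at level n have w(n) + n elements, w(n) being the number of nodes at
  that level. Almost every X meets all successor sets from some level on and hence contains the
  tail of a branch, whose range is Y. Any Z computed from such a Y by a fixed program is determined on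
  w(n) + n bits by a node at level n, hence lies in a set of measure at most
  w(n) / 2^(w(n) + n) <= 2^(-n) for all large n, which is a null set; remove these countably many
  null sets.
*)

theory Submission
  imports Defs
begin

section \<open>Oracle computations: determinism and finite use\<close>

inductive_cases computes_CompE: "computes Y (Comp f gs) xs w"
inductive_cases computes_PrimRec_0E: "computes Y (PrimRec f g) (0 # xs) w"
inductive_cases computes_PrimRec_SucE: "computes Y (PrimRec f g) (Suc n # xs) w"
inductive_cases computes_SearchE: "computes Y (Search f) xs w"

lemma computes_deterministic:
  "computes Y p xs v \<Longrightarrow> computes Y p xs w \<Longrightarrow> v = w"
proof (induction arbitrary: w rule: computes.induct)
  case (Comp xs gs vs f v)
  from Comp.prems obtain us where us: "list_all2 (\<lambda>g v. computes Y g xs v) gs us" "computes Y f us w"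
    by (rule computes_CompE)
  have "us = vs"
  proof (rule nth_equalityI)
    show "length us = length vs"
      using list_all2_lengthD[OF Comp.IH(1)] list_all2_lengthD[OF us(1)] by simp
    fix i assume i: "i < length us"
    then have "computes Y (gs ! i) xs (us ! i)" and "i < length gs"
      using us(1) by (auto simp: list_all2_conv_all_nth)
    moreover have "\<forall>w. computes Y (gs ! i) xs w \<longrightarrow> vs ! i = w"
      using list_all2_nthD[OF Comp.IH(1) \<open>i < length gs\<close>] by (rule conjunct2)
    ultimately show "us ! i = vs ! i" by (auto dest!: spec[of _ "us ! i"])
  qed
  then show ?case using Comp.IH(2) us(2) by simp
next
  case (PrimRec_Suc f g n xs r v)
  from PrimRec_Suc.prems obtain r' where "computes Y (PrimRec f g) (n # xs) r'" "computes Y g (n # r' # xs) w"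
    by (rule computes_PrimRec_SucE)
  then show ?case using PrimRec_Suc.IH by metis
next
  case (Search f n xs)
  from Search.prems have "computes Y f (w # xs) 0" "\<forall>m<w. \<exists>r. computes Y f (m # xs) (Suc r)"
    by (auto elim: computes_SearchE)
  then show ?case
    using Search.IH by (metis Zero_not_Suc nat_neq_iff)
next
  case (PrimRec_0 f xs v g)
  from PrimRec_0.prems have "computes Y f xs w" by (rule computes_PrimRec_0E)
  then show ?case by (rule PrimRec_0.IH)
qed (erule computes.cases; simp)+

lemma Int_lessThan_cong_mono:
  fixes m n :: "'a :: preorder"
  assumes "A \<inter> {..<m} = B \<inter> {..<m}" and "n \<le> m"
  shows "A \<inter> {..<n} = B \<inter> {..<n}"
proof -
  have "{..<n} = {..<m} \<inter> {..<n}" using assms(2) by (auto intro: less_le_trans)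
  then show ?thesis using assms(1) by (metis Int_assoc)
qed

text \<open>A halting computation has a finite derivation and so asks only finitely many oracle
  questions. At each rule the maximum of the bounds for the subcomputations serves; this is where
  convergence becomes an open condition on the oracle.\<close>

lemma computes_finite_use:
  "computes Y p xs v \<Longrightarrow> \<exists>n. \<forall>Y'. Y' \<inter> {..<n} = Y \<inter> {..<n} \<longrightarrow> computes Y' p xs v"
proof (induction rule: computes.induct)
  case (Oracle x)
  have "computes Y' Oracle [x] (of_bool (x \<in> Y))" if "Y' \<inter> {..<Suc x} = Y \<inter> {..<Suc x}" for Y'
  proof -
    have "x \<in> Y \<longleftrightarrow> x \<in> Y'" using that by blast
    then show ?thesis using computes.Oracle[of Y' x] by simp
  qed
  then show ?case by blast
next
  case (Comp xs gs vs f w)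
  have "\<forall>i. \<exists>n. i < length gs \<longrightarrow>
      (\<forall>Y'. Y' \<inter> {..<n} = Y \<inter> {..<n} \<longrightarrow> computes Y' (gs ! i) xs (vs ! i))"
    using Comp.IH(1) by (auto simp: list_all2_conv_all_nth)
  then obtain N where N: "\<And>i Y'. i < length gs \<Longrightarrow> Y' \<inter> {..<N i} = Y \<inter> {..<N i} \<Longrightarrow>
      computes Y' (gs ! i) xs (vs ! i)"
    by metis
  obtain k where k: "\<And>Y'. Y' \<inter> {..<k} = Y \<inter> {..<k} \<Longrightarrow> computes Y' f vs w"
    using Comp.IH(2) by blast
  define M where "M = Max (insert k (N ` {..<length gs}))"
  have M: "k \<le> M" "\<And>i. i < length gs \<Longrightarrow> N i \<le> M"
    unfolding M_def by (auto intro!: Max_ge)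
  have len: "length gs = length vs" using Comp.IH(1) by (auto simp: list_all2_conv_all_nth)
  have "computes Y' (Comp f gs) xs w" if "Y' \<inter> {..<M} = Y \<inter> {..<M}" for Y'
  proof (rule computes.Comp)
    show "computes Y' f vs w" by (intro k Int_lessThan_cong_mono[OF that] M)
    show "list_all2 (\<lambda>g v. computes Y' g xs v) gs vs"
      unfolding list_all2_conv_all_nth using len N Int_lessThan_cong_mono[OF that M(2)] by simp
  qed
  then show ?case by blast
next
  case (PrimRec_0 f xs v g)
  then show ?case by (blast intro: computes.PrimRec_0)
next
  case (PrimRec_Suc f g n xs r v)
  then obtain a b where
    ab: "\<And>Y'. Y' \<inter> {..<a} = Y \<inter> {..<a} \<Longrightarrow> computes Y' (PrimRec f g) (n # xs) r"
      "\<And>Y'. Y' \<inter> {..<b} = Y \<inter> {..<b} \<Longrightarrow> computes Y' g (n # r # xs) v"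
    by blast
  have "computes Y' (PrimRec f g) (Suc n # xs) v"
    if "Y' \<inter> {..<max a b} = Y \<inter> {..<max a b}" for Y'
    by (intro computes.PrimRec_Suc[where r = r] ab Int_lessThan_cong_mono[OF that]) simp_all
  then show ?case by blast
next
  case (Search f n xs)
  from Search.IH(1) obtain k where
    k: "\<And>Y'. Y' \<inter> {..<k} = Y \<inter> {..<k} \<Longrightarrow> computes Y' f (n # xs) 0"
    by blast
  from Search.IH(2) have "\<forall>m. \<exists>a r. m < n \<longrightarrow>
      (\<forall>Y'. Y' \<inter> {..<a} = Y \<inter> {..<a} \<longrightarrow> computes Y' f (m # xs) (Suc r))"
    by blast
  then obtain N R where N: "\<And>m Y'. m < n \<Longrightarrow> Y' \<inter> {..<N m} = Y \<inter> {..<N m} \<Longrightarrow>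
      computes Y' f (m # xs) (Suc (R m))"
    by metis
  define M where "M = Max (insert k (N ` {..<n}))"
  have M: "k \<le> M" "\<And>i. i < n \<Longrightarrow> N i \<le> M"
    unfolding M_def by (auto intro!: Max_ge)
  have "computes Y' (Search f) xs n" if "Y' \<inter> {..<M} = Y \<inter> {..<M}" for Y'
  proof (rule computes.Search)
    show "computes Y' f (n # xs) 0" by (intro k Int_lessThan_cong_mono[OF that] M)
    show "\<forall>m<n. \<exists>r. computes Y' f (m # xs) (Suc r)"
      using N Int_lessThan_cong_mono[OF that M(2)] by metis
  qed
  then show ?case by blast
qed (auto intro: computes.intros)

instance recf :: countable
  by countable_datatype

section \<open>Infinitely branching trees: pure decision and fusion\<close>

definition initial :: "(nat \<Rightarrow> nat) \<Rightarrow> nat \<Rightarrow> nat list" where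
  "initial x n = map x [0..<n]"

lemma length_initial [simp]: "length (initial x n) = n"
  by (simp add: initial_def)

lemma nth_initial [simp]: "i < n \<Longrightarrow> initial x n ! i = x i"
  by (simp add: initial_def)

lemma initial_0 [simp]: "initial x 0 = []"
  by (simp add: initial_def)

lemma initial_Suc: "initial x (Suc n) = initial x n @ [x n]"
  by (simp add: initial_def)

lemma take_initial: "m \<le> n \<Longrightarrow> take m (initial x n) = initial x m"
  by (simp add: initial_def take_map)

text \<open>A tree is given by the set of admissible one-element extensions of every finite sequence,
  whether or not that sequence is itself a node.\<close>

definition pruning :: "(nat list \<Rightarrow> nat set) \<Rightarrow> (nat list \<Rightarrow> nat set) \<Rightarrow> bool" where
  "pruning T' T \<longleftrightarrow> (\<forall>s. infinite (T' s) \<and> T' s \<subseteq> T s)"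

text \<open>Nothing is required below level \<open>n\<close>, so forcing makes sense at every finite
  sequence and not only at nodes of the tree.\<close>

definition branch_from :: "nat \<Rightarrow> (nat list \<Rightarrow> nat set) \<Rightarrow> (nat \<Rightarrow> nat) \<Rightarrow> bool" where
  "branch_from n T x \<longleftrightarrow> (\<forall>m\<ge>n. x m \<in> T (initial x m))"

definition forces :: "((nat \<Rightarrow> nat) \<Rightarrow> bool) \<Rightarrow> (nat list \<Rightarrow> nat set) \<Rightarrow> nat list \<Rightarrow> bool" where
  "forces P T s \<longleftrightarrow> (\<forall>x. branch_from (length s) T x \<and> initial x (length s) = s \<longrightarrow> P x)"

definition open_pred :: "((nat \<Rightarrow> nat) \<Rightarrow> bool) \<Rightarrow> bool" where
  "open_pred P \<longleftrightarrow> (\<forall>x. P x \<longrightarrow> (\<exists>n. \<forall>x'. initial x' n = initial x n \<longrightarrow> P x'))"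

lemma pruning_trans: "pruning T'' T' \<Longrightarrow> pruning T' T \<Longrightarrow> pruning T'' T"
  unfolding pruning_def by blast

lemma forces_pruning: "forces P T s \<Longrightarrow> pruning T' T \<Longrightarrow> forces P T' s"
  unfolding forces_def pruning_def branch_from_def by blast

text \<open>Gluing: keep at \<open>s\<close> only the successors that can be made to force
  \<open>P\<close>, and above each of them use its own pruned tree. A branch through
  \<open>s\<close> picks one such successor and then stays in the corresponding tree.\<close>

lemma forces_from_extensions:
  assumes "\<And>t. infinite (T t)"
    and inf: "infinite {c \<in> T s. \<exists>T'. pruning T' T \<and> forces P T' (s @ [c])}"
  shows "\<exists>T'. pruning T' T \<and> forces P T' s"
proof -
  define D where "D = {c \<in> T s. \<exists>T'. pruning T' T \<and> forces P T' (s @ [c])}"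
  have "\<forall>c\<in>D. \<exists>T'. pruning T' T \<and> forces P T' (s @ [c])" by (simp add: D_def)
  then obtain U where U: "\<And>c. c \<in> D \<Longrightarrow> pruning (U c) T \<and> forces P (U c) (s @ [c])"
    by metis
  \<comment> \<open>Only the entry at position \<open>length s\<close> is tested, not whether
    \<open>t\<close> extends \<open>s\<close>; this is harmless, since only branches through
    \<open>s\<close> are considered.\<close>
  define T' where "T' t = (if t = s then D
    else if length s < length t \<and> t ! length s \<in> D then U (t ! length s) t else T t)" for t
  have "infinite D" "D \<subseteq> T s" using inf by (auto simp: D_def)
  then have "pruning T' T" using assms(1) U unfolding pruning_def T'_def by simp
  moreover have "forces P T' s"
    unfolding forces_def
  proof (intro allI impI, elim conjE)
    fix x assume x: "branch_from (length s) T' x" "initial x (length s) = s"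
    let ?c = "x (length s)"
    have c: "?c \<in> D" using x unfolding branch_from_def T'_def by fastforce
    have "x m \<in> U ?c (initial x m)" if "Suc (length s) \<le> m" for m
    proof -
      have "x m \<in> T' (initial x m)" using x that unfolding branch_from_def by auto
      moreover have "initial x m \<noteq> s" using that by (metis length_initial Suc_n_not_le_n)
      ultimately show ?thesis using c that unfolding T'_def by simp
    qed
    then have "branch_from (length (s @ [?c])) (U ?c) x" by (auto simp: branch_from_def)
    moreover have "initial x (length (s @ [?c])) = s @ [?c]" using x(2) by (simp add: initial_Suc)
    ultimately show "P x" using U[OF c] unfolding forces_def by blast
  qed
  ultimately show ?thesis by blast
qed

text \<open>If no pruning forces \<open>P\<close> at \<open>s\<close>, then by gluing each bad
  sequence has only finitely many good one-element extensions. Discarding these keeps every branch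
  through \<open>s\<close> bad forever, whereas a branch satisfying the open \<open>P\<close> would
  reach a good initial segment.\<close>

lemma decide:
  assumes inf: "\<And>t. infinite (T t)" and P: "open_pred P"
  shows "\<exists>T'. pruning T' T \<and> (forces P T' s \<or> forces (\<lambda>x. \<not> P x) T' s)"
proof -
  define good where "good t \<longleftrightarrow> (\<exists>T'. pruning T' T \<and> forces P T' t)" for t
  show ?thesis
  proof (cases "good s")
    case True
    then show ?thesis unfolding good_def by blast
  next
    case False
    \<comment> \<open>At good sequences nothing is removed: branches through the bad
      \<open>s\<close> never reach them, and the successor sets there must stay infinite.\<close>
    define T' where "T' t = (if good t then T t else {c \<in> T t. \<not> good (t @ [c])})" for t
    have "infinite (T' t)" for t
    proof (cases "good t")
      case False
      then have "finite {c \<in> T t. good (t @ [c])}"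
        using forces_from_extensions[of T t P, OF inf] unfolding good_def by blast
      then have "infinite (T t - {c \<in> T t. good (t @ [c])})" using inf by (rule Diff_infinite_finite)
      moreover have "T t - {c \<in> T t. good (t @ [c])} = T' t" using False by (auto simp: T'_def)
      ultimately show ?thesis by simp
    qed (simp add: T'_def inf)
    then have "pruning T' T" unfolding pruning_def T'_def by auto
    moreover have "forces (\<lambda>x. \<not> P x) T' s"
      unfolding forces_def
    proof (intro allI impI notI, elim conjE)
      fix x assume x: "branch_from (length s) T' x" "initial x (length s) = s" and "P x"
      have bad: "\<not> good (initial x m)" if "length s \<le> m" for m
        using that
      proof (induction m rule: dec_induct)
        case base
        then show ?case using False x by simp
      next
        case (step m)
        then have "x m \<in> T' (initial x m)" using x by (auto simp: branch_from_def)
        then show ?case using step by (simp add: T'_def initial_Suc)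
      qed
      obtain n where n: "\<And>x'. initial x' n = initial x n \<Longrightarrow> P x'"
        using P \<open>P x\<close> unfolding open_pred_def by blast
      \<comment> \<open>Length at least \<open>n\<close> lets openness apply; length at least
        \<open>length s\<close> puts the segment among those already shown to be bad.\<close>
      have "forces P T (initial x (max n (length s)))"
        unfolding forces_def
      proof (intro allI impI, elim conjE)
        fix x' assume "initial x' (length (initial x (max n (length s)))) = initial x (max n (length s))"
        then have "take n (initial x' (max n (length s))) = take n (initial x (max n (length s)))"
          by simp
        then show "P x'" by (intro n) (simp add: take_initial)
      qed
      moreover have "pruning T T" using inf by (simp add: pruning_def)
      ultimately have "good (initial x (max n (length s)))" unfolding good_def by blast
      then show False using bad by simp
    qed
    ultimately show ?thesis by blast
  qed
qed

definition decides_level :: "((nat \<Rightarrow> nat) \<Rightarrow> bool) \<Rightarrow> (nat list \<Rightarrow> nat set) \<Rightarrow> nat \<Rightarrow> bool" where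
  "decides_level P T n \<longleftrightarrow> (\<forall>s. length s = n \<longrightarrow> forces P T s \<or> forces (\<lambda>x. \<not> P x) T s)"

lemma decides_level_pruning: "decides_level P T n \<Longrightarrow> pruning T' T \<Longrightarrow> decides_level P T' n"
  unfolding decides_level_def using forces_pruning by blast

text \<open>Distinct sequences of length \<open>n\<close> have disjoint sets of extensions, so their
  separate prunings combine without touching the tree below level \<open>n\<close>. That lower part
  staying fixed is what makes fusion possible.\<close>

lemma decide_level:
  assumes inf: "\<And>t. infinite (T t)" and P: "open_pred P"
  shows "\<exists>T'. pruning T' T \<and> (\<forall>s. length s < n \<longrightarrow> T' s = T s) \<and> decides_level P T' n"
proof -
  have "\<exists>U. \<forall>s. pruning (U s) T \<and> (forces P (U s) s \<or> forces (\<lambda>x. \<not> P x) (U s) s)"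
    by (intro choice allI decide[OF inf P])
  then obtain U where U: "\<And>s. pruning (U s) T \<and> (forces P (U s) s \<or> forces (\<lambda>x. \<not> P x) (U s) s)"
    by blast
  define T' where "T' t = (if length t < n then T t else U (take n t) t)" for t
  have "pruning T' T" using U inf unfolding pruning_def T'_def by auto
  moreover have "forces Q T' s" if "forces Q (U s) s" "length s = n" for Q s
    unfolding forces_def
  proof (intro allI impI, elim conjE)
    fix x assume x: "branch_from (length s) T' x" "initial x (length s) = s"
    have "branch_from (length s) (U s) x"
      unfolding branch_from_def
    proof (intro allI impI)
      fix m assume "length s \<le> m"
      then show "x m \<in> U s (initial x m)"
        using x that(2) unfolding branch_from_def T'_def by (force simp: take_initial)
    qed
    then show "Q x" using that x unfolding forces_def by blast
  qed
  moreover from this U have "decides_level P T' n" unfolding decides_level_def by blast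
  ultimately show ?thesis by (intro exI[of _ T']) (simp add: T'_def)
qed

lemma decide_level_finite:
  assumes "finite K" and inf: "\<And>t. infinite (T t)" and "\<And>k. open_pred (P k)"
  shows "\<exists>T'. pruning T' T \<and> (\<forall>s. length s < n \<longrightarrow> T' s = T s) \<and>
    (\<forall>k\<in>K. decides_level (P k) T' n)"
  using assms(1)
proof (induction K)
  case empty
  show ?case using inf by (intro exI[of _ T]) (auto simp: pruning_def)
next
  case (insert k K)
  then obtain T1 where T1: "pruning T1 T" "\<forall>s. length s < n \<longrightarrow> T1 s = T s"
    "\<forall>k\<in>K. decides_level (P k) T1 n" by blast
  then have "\<And>t. infinite (T1 t)" by (simp add: pruning_def)
  from decide_level[of T1 "P k" n, OF this assms(3)] obtain T2 where
    "pruning T2 T1" "\<forall>s. length s < n \<longrightarrow> T2 s = T1 s" "decides_level (P k) T2 n"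
    by blast
  with T1 have "pruning T2 T \<and> (\<forall>s. length s < n \<longrightarrow> T2 s = T s) \<and>
      (\<forall>k\<in>insert k K. decides_level (P k) T2 n)"
    by (auto intro: pruning_trans decides_level_pruning)
  then show ?case by blast
qed

text \<open>Stage \<open>Suc n\<close> settles the predicates in \<open>K n\<close> at level
  \<open>n\<close> and alters no successor set at a shorter sequence. Each successor set therefore
  stabilises, and the limit tree prunes every stage and inherits all decisions.\<close>

lemma fusion:
  assumes inf: "\<And>t. infinite (T t)" and "\<And>k. open_pred (P k)" and "\<And>n. finite (K n)"
  shows "\<exists>T'. pruning T' T \<and> (\<forall>n. \<forall>k\<in>K n. decides_level (P k) T' n)"
proof -
  have "\<exists>U. \<forall>n. pruning (U n) T \<and> (pruning (U (Suc n)) (U n) \<and>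
      (\<forall>s. length s < n \<longrightarrow> U (Suc n) s = U n s) \<and> (\<forall>k\<in>K n. decides_level (P k) (U (Suc n)) n))"
  proof (rule dependent_nat_choice)
    show "\<exists>U. pruning U T" using inf by (intro exI[of _ T]) (auto simp: pruning_def)
  next
    fix U n assume U: "pruning U T"
    then have infU: "\<And>t. infinite (U t)" by (simp add: pruning_def)
    obtain U' where "pruning U' U" "\<forall>s. length s < n \<longrightarrow> U' s = U s"
      "\<forall>k\<in>K n. decides_level (P k) U' n"
      using decide_level_finite[of "K n" U P n] assms(2,3) infU by blast
    with U show "\<exists>U'. pruning U' T \<and> (pruning U' U \<and>
      (\<forall>s. length s < n \<longrightarrow> U' s = U s) \<and> (\<forall>k\<in>K n. decides_level (P k) U' n))"
      using pruning_trans[of U' U T] by blast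
  qed
  then obtain U where U: "\<And>n. pruning (U n) T" "\<And>n. pruning (U (Suc n)) (U n)"
    "\<And>n s. length s < n \<Longrightarrow> U (Suc n) s = U n s"
    "\<And>n k. k \<in> K n \<Longrightarrow> decides_level (P k) (U (Suc n)) n"
    by blast
  \<comment> \<open>Stage \<open>Suc (length s)\<close> is the first from which the successor set at
    \<open>s\<close> is guaranteed not to change.\<close>
  define T' where "T' s = U (Suc (length s)) s" for s
  have stable: "U n s = T' s" if "length s < n" for n s
    using that unfolding T'_def
    by (induction n) (use U(3) less_Suc_eq in auto)
  have decreasing: "U n s \<subseteq> U m s" if "m \<le> n" for m n s
    using that U(2) by (induction n rule: dec_induct) (auto simp: pruning_def)
  have prune: "pruning T' (U n)" for n
    unfolding pruning_def
  proof (intro allI conjI)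
    fix s
    show "infinite (T' s)" using U(1) by (simp add: T'_def pruning_def)
    have "T' s = U (max n (Suc (length s))) s" by (rule stable[symmetric]) simp
    then show "T' s \<subseteq> U n s" using decreasing[of n "max n (Suc (length s))"] by simp
  qed
  have "decides_level (P k) T' n" if "k \<in> K n" for k n
    using U(4)[OF that] prune by (rule decides_level_pruning)
  moreover have "pruning T' T" using prune U(1) by (rule pruning_trans)
  ultimately show ?thesis by blast
qed

section \<open>Measure of cylinders under the fair coin\<close>

interpretation coin: product_prob_space "\<lambda>_::nat. measure_pmf (bernoulli_pmf (1 / 2))" UNIV
  by unfold_locales

lemma space_fair_coin [simp]: "space fair_coin = UNIV"
  by (simp add: fair_coin_def space_PiM)

lemma prob_space_fair_coin: "prob_space fair_coin"
  unfolding fair_coin_def by (rule coin.prob_space_axioms)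

lemma cylinder_sets [measurable]: "finite J \<Longrightarrow> {X. \<forall>j\<in>J. X j = v j} \<in> sets fair_coin"
proof -
  assume "finite J"
  then have "{X \<in> space (\<Pi>\<^sub>M i\<in>UNIV. measure_pmf (bernoulli_pmf (1 / 2))). \<forall>j\<in>J. X j = v j}
      \<in> sets (\<Pi>\<^sub>M i\<in>UNIV. measure_pmf (bernoulli_pmf (1 / 2)))"
    by measurable
  then show ?thesis by (simp add: fair_coin_def space_PiM)
qed

lemma measure_cylinder:
  assumes "finite J"
  shows "measure fair_coin {X. \<forall>j\<in>J. X j = v j} = (1 / 2) ^ card J"
proof -
  have 1: "{X. \<forall>j\<in>J. X j = v j} =
      prod_emb UNIV (\<lambda>_. measure_pmf (bernoulli_pmf (1 / 2))) J (\<Pi>\<^sub>E j\<in>J. {v j})"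
    by (simp add: prod_emb_def PiE_iff vimage_def)
  have 2: "measure (measure_pmf (bernoulli_pmf (1 / 2))) {b} = 1 / 2" for b
    by (cases b) (simp_all add: measure_pmf_single)
  have "measure fair_coin {X. \<forall>j\<in>J. X j = v j} =
      (\<Prod>j\<in>J. measure (measure_pmf (bernoulli_pmf (1 / 2))) {v j})"
    unfolding 1 fair_coin_def using assms by (intro coin.measure_PiM_emb) auto
  then show ?thesis by (simp only: 2 prod_constant)
qed

section \<open>Counting nodes of a finitely branching subtree\<close>

primrec width :: "nat \<Rightarrow> nat" where
  "width 0 = 1"
| "width (Suc n) = width n * (width n + n)"

text \<open>The summand \<open>width n\<close> in the exponent absorbs the number of nodes, as
  \<open>width n\<close> is below \<open>2 ^ width n\<close>; the summand \<open>n\<close> leaves a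
  summable bound.\<close>

lemma width_bound: "real (width n) * (1 / 2) ^ (width n + n) \<le> (1 / 2) ^ n"
proof -
  have "real (width n) \<le> 2 ^ width n" by (rule less_imp_le) (rule of_nat_less_two_power)
  then show ?thesis by (simp add: power_add field_simps)
qed

primrec nodes :: "(nat list \<Rightarrow> nat set) \<Rightarrow> nat \<Rightarrow> nat list set" where
  "nodes C 0 = {[]}"
| "nodes C (Suc n) = (\<Union>s\<in>nodes C n. (\<lambda>c. s @ [c]) ` C s)"

lemma length_nodes: "s \<in> nodes C n \<Longrightarrow> length s = n"
  by (induction n arbitrary: s) auto

lemma finite_nodes: "(\<And>s. finite (C s)) \<Longrightarrow> finite (nodes C n)"
  by (induction n) auto

lemma initial_in_nodes: "(\<And>n. x n \<in> C (initial x n)) \<Longrightarrow> initial x n \<in> nodes C n"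
  by (induction n) (auto simp: initial_Suc)

lemma card_nodes_le:
  assumes fin: "\<And>s. finite (C s)" and card: "\<And>s. card (C s) = width (length s) + length s"
  shows "card (nodes C n) \<le> width n"
proof (induction n)
  case (Suc n)
  have "card (nodes C (Suc n)) \<le> (\<Sum>s\<in>nodes C n. card ((\<lambda>c. s @ [c]) ` C s))"
    unfolding nodes.simps by (rule card_UN_le) (rule finite_nodes[OF fin])
  also have "\<dots> \<le> (\<Sum>s\<in>nodes C n. width n + n)"
    using card by (intro sum_mono) (metis card_image_le fin length_nodes)
  also have "\<dots> \<le> width n * (width n + n)" using Suc by simp
  finally show ?case by simp
qed simp

text \<open>This union bound over nodes serves twice: for sets missing some successor set, and for
  sets agreeing with the bits predicted by some node.\<close>

lemma measure_UN_cylinders_le: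
  assumes "finite S" and "\<And>s. s \<in> S \<Longrightarrow> finite (J s)" and "\<And>s. s \<in> S \<Longrightarrow> card (J s) = k"
  shows "measure fair_coin (\<Union>s\<in>S. {X. \<forall>j\<in>J s. X j = v s j}) \<le> real (card S) * (1 / 2) ^ k"
proof -
  interpret prob_space fair_coin by (rule prob_space_fair_coin)
  have "measure fair_coin (\<Union>s\<in>S. {X. \<forall>j\<in>J s. X j = v s j}) \<le>
      (\<Sum>s\<in>S. measure fair_coin {X. \<forall>j\<in>J s. X j = v s j})"
    using assms by (intro finite_measure_subadditive_finite) (auto intro: cylinder_sets)
  also have "\<dots> = real (card S) * (1 / 2) ^ k" using assms by (simp add: measure_cylinder)
  finally show ?thesis .
qed

section \<open>A tree deciding computations from tails of its branches\<close>

text \<open>The range of \<open>x\<close> restricted to arguments \<open>\<ge> N\<close>, provided that \<open>n \<le> x n\<close>. The bound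
  \<open>n \<le> y\<close> makes membership depend on finitely many values of an arbitrary \<open>x\<close>.\<close>

definition tail_range :: "nat \<Rightarrow> (nat \<Rightarrow> nat) \<Rightarrow> nat set" where
  "tail_range N x = {y. \<exists>n\<ge>N. n \<le> y \<and> x n = y}"

text \<open>By finite use only oracle elements below some \<open>n\<close> matter, and such an
  element \<open>y\<close> can occur only as \<open>x i\<close> with
  \<open>i \<le> y < n\<close>.\<close>

lemma open_pred_computes: "open_pred (\<lambda>x. computes (tail_range N x) p xs v)"
  unfolding open_pred_def
proof (intro allI impI)
  fix x assume "computes (tail_range N x) p xs v"
  then obtain n where n: "\<And>Y'. Y' \<inter> {..<n} = tail_range N x \<inter> {..<n} \<Longrightarrow> computes Y' p xs v"
    using computes_finite_use by blast
  have "computes (tail_range N x') p xs v" if "initial x' n = initial x n" for x'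
  proof (rule n)
    have "x' i = x i" if "i < n" for i
      using \<open>initial x' n = initial x n\<close> that by (metis nth_initial)
    then show "tail_range N x' \<inter> {..<n} = tail_range N x \<inter> {..<n}"
      unfolding tail_range_def by (auto simp: set_eq_iff)
  qed
  then show "\<exists>n. \<forall>x'. initial x' n = initial x n \<longrightarrow> computes (tail_range N x') p xs v" by blast
qed

lemma finite_to_nat_le: "finite {p::'a::countable. to_nat p \<le> n}"
  by (rule finite_subset[OF _ finite_imageI[of "{..n}" from_nat]]) (auto intro!: image_eqI[of _ _ "to_nat _"])

text \<open>Fusion starts from the successor sets \<open>{length s..}\<close>, so that branches
  satisfy \<open>n \<le> x n\<close> and \<open>tail_range\<close> loses none of their values. The
  starting point \<open>N\<close> of the tail is decided along with the program because it will
  depend on \<open>X\<close>.\<close>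

lemma deciding_tree:
  obtains T where "\<And>s. infinite (T s)" "\<And>s. T s \<subseteq> {length s..}"
    "\<And>p N m n. to_nat p \<le> n \<Longrightarrow> N \<le> n \<Longrightarrow> m < width n + n \<Longrightarrow>
      decides_level (\<lambda>x. computes (tail_range N x) p [m] 1) T n"
proof -
  define P where "P = (\<lambda>(p, N, m) x. computes (tail_range N x) p [m] 1)"
  define K where "K n = {p::recf. to_nat p \<le> n} \<times> {..n} \<times> {..<width n + n}" for n
  have "open_pred (P k)" for k
    unfolding P_def by (cases k) (simp add: open_pred_computes del: One_nat_def)
  moreover have "finite (K n)" for n by (simp add: K_def finite_to_nat_le)
  moreover have "infinite {length s..}" for s :: "nat list" by (rule infinite_Ici)
  ultimately obtain T where T: "pruning T (\<lambda>s. {length s..})"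
    "\<And>n k. k \<in> K n \<Longrightarrow> decides_level (P k) T n"
    using fusion[of "\<lambda>s. {length s..}" P K] by blast
  show thesis
  proof
    show "infinite (T s)" "T s \<subseteq> {length s..}" for s using T(1) by (auto simp: pruning_def)
    show "decides_level (\<lambda>x. computes (tail_range N x) p [m] 1) T n"
      if "to_nat p \<le> n" "N \<le> n" "m < width n + n" for p N m n
      using T(2)[of "(p, N, m)" n] that by (simp add: K_def P_def)
  qed
qed

section \<open>The almost sure event\<close>

text \<open>A fixed successor set at level \<open>n\<close> is missed with probability
  \<open>(1 / 2) ^ (width n + n)\<close>. Summing over at most \<open>width n\<close> nodes gives at
  most \<open>(1 / 2) ^ n\<close>, and Borel-Cantelli applies.\<close>

lemma almost_every_set_meets_tree:
  assumes fin: "\<And>s. finite (C s)" and card: "\<And>s. card (C s) = width (length s) + length s"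
  shows "AE X in fair_coin. \<exists>N. \<forall>n\<ge>N. \<forall>s\<in>nodes C n. \<exists>c\<in>C s. X c"
proof -
  interpret prob_space fair_coin by (rule prob_space_fair_coin)
  define F where "F n = (\<Union>s\<in>nodes C n. {X. \<forall>c\<in>C s. X c = False})" for n
  have F: "F n \<in> sets fair_coin" for n
    unfolding F_def using fin finite_nodes[OF fin] by (intro sets.finite_UN cylinder_sets) auto
  have "measure fair_coin (F n) \<le> (1 / 2) ^ n" for n
  proof -
    have "measure fair_coin (F n) \<le> real (card (nodes C n)) * (1 / 2) ^ (width n + n)"
      unfolding F_def
      by (intro measure_UN_cylinders_le finite_nodes fin) (simp add: card length_nodes)
    also have "\<dots> \<le> real (width n) * (1 / 2) ^ (width n + n)"
      using card_nodes_le[OF fin card] by (intro mult_right_mono) auto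
    finally show ?thesis using width_bound[of n] by linarith
  qed
  then have "summable (\<lambda>n. measure fair_coin (F n))"
    by (intro summable_comparison_test'[OF summable_geometric[of "1 / 2 :: real"]]) auto
  then have "AE X in fair_coin. eventually (\<lambda>n. X \<in> space fair_coin - F n) sequentially"
    using F by (intro borel_cantelli_AE1) (auto simp: emeasure_eq_measure)
  then show ?thesis
    by (rule AE_mp) (auto simp: F_def eventually_sequentially)
qed

theorem corollary4p5:
  "\<exists>A \<in> sets fair_coin. measure fair_coin A = 1 \<and>
     (\<forall>X. char_seq X \<in> A \<longrightarrow>
       (\<exists>Y \<subseteq> X. infinite Y \<and> (\<forall>Z. char_seq Z \<in> A \<longrightarrow> \<not> turing_reducible Z Y)))"
proof -
  interpret prob_space fair_coin by (rule prob_space_fair_coin)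
  obtain T where T: "\<And>s. infinite (T s)" "\<And>s. T s \<subseteq> {length s..}"
    "\<And>p N m n. to_nat p \<le> n \<Longrightarrow> N \<le> n \<Longrightarrow> m < width n + n \<Longrightarrow>
      decides_level (\<lambda>x. computes (tail_range N x) p [m] 1) T n"
    using deciding_tree by blast
  have "\<forall>s. \<exists>B. finite B \<and> card B = width (length s) + length s \<and> B \<subseteq> T s"
    using infinite_arbitrarily_large[OF T(1)] by blast
  then obtain C where C: "\<And>s. finite (C s)" "\<And>s. card (C s) = width (length s) + length s"
    "\<And>s. C s \<subseteq> T s"
    by metis
  have width_pos: "0 < width n + n" for n by (induction n) auto
  have C_ne: "C s \<noteq> {}" for s using C(2)[of s] width_pos[of "length s"] by auto
  \<comment> \<open>The bit predicted by \<open>s\<close>: at a level where the question is decided,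
    not forcing the output 1 means forcing its negation, so the prediction is right for every branch
    of \<open>T\<close> through \<open>s\<close>.\<close>
  define v where "v p N s m \<longleftrightarrow> forces (\<lambda>x. computes (tail_range N x) p [m] 1) T s" for p N s m
  define B where "B p N n = (\<Union>s\<in>nodes C n. {Z. \<forall>m\<in>{..<width n + n}. Z m = v p N s m})" for p N n
  \<comment> \<open>From level \<open>max (to_nat p) N\<close> on, the tree decides \<open>p\<close>
    with tail start \<open>N\<close>. Thus \<open>H p N\<close> contains every set that
    \<open>p\<close> computes from such a tail of a branch of \<open>C\<close>.\<close>
  define H where "H p N = (\<Inter>n\<in>{max (to_nat p) N..}. B p N n)" for p N
  have B_sets: "B p N n \<in> sets fair_coin" for p N n
    unfolding B_def using finite_nodes[OF C(1)] by (intro sets.finite_UN cylinder_sets) auto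
  have H_sets: "H p N \<in> sets fair_coin" for p N
    unfolding H_def using B_sets by (intro sets.countable_INT') auto
  have H_null: "H p N \<in> null_sets fair_coin" for p N
  proof -
    have "measure fair_coin (H p N) \<le> (1 / 2) ^ n" if "max (to_nat p) N \<le> n" for n
    proof -
      have "measure fair_coin (H p N) \<le> measure fair_coin (B p N n)"
        using that B_sets by (intro finite_measure_mono) (auto simp: H_def)
      also have "\<dots> \<le> real (card (nodes C n)) * (1 / 2) ^ (width n + n)"
        unfolding B_def by (intro measure_UN_cylinders_le finite_nodes C(1)) auto
      also have "\<dots> \<le> real (width n) * (1 / 2) ^ (width n + n)"
        using card_nodes_le[OF C(1,2)] by (intro mult_right_mono) auto
      finally show ?thesis using width_bound[of n] by linarith
    qed
    moreover have "(\<lambda>n. (1 / 2 :: real) ^ n) \<longlonglongrightarrow> 0" by (rule LIMSEQ_realpow_zero) auto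
    ultimately have "measure fair_coin (H p N) \<le> 0"
      by (intro LIMSEQ_le_const) blast+
    then have "measure fair_coin (H p N) = 0" by (simp add: measure_le_0_iff)
    then show ?thesis using H_sets by (auto simp: emeasure_eq_measure)
  qed
  have "AE X in fair_coin. \<forall>p N. X \<notin> H p N"
    using H_null by (simp add: AE_all_countable AE_not_in)
  with almost_every_set_meets_tree[OF C(1,2)]
  have "AE X in fair_coin. (\<exists>N. \<forall>n\<ge>N. \<forall>s\<in>nodes C n. \<exists>c\<in>C s. X c) \<and> (\<forall>p N. X \<notin> H p N)"
    by (rule AE_conjI)
  \<comment> \<open>The exceptional set is enclosed in a measurable null set, so that the complement
    \<open>A\<close> is an event of the uncompleted measure space.\<close>
  then obtain M where M: "{X \<in> space fair_coin. \<not> ((\<exists>N. \<forall>n\<ge>N. \<forall>s\<in>nodes C n. \<exists>c\<in>C s. X c) \<and> (\<forall>p N. X \<notin> H p N))} \<subseteq> M"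
    "emeasure fair_coin M = 0" "M \<in> sets fair_coin"
    by (rule AE_E)
  define A where "A = space fair_coin - M"
  have A_meets: "\<exists>N. \<forall>n\<ge>N. \<forall>s\<in>nodes C n. \<exists>c\<in>C s. X c" and A_notin: "X \<notin> H p N" if "X \<in> A" for X p N
    using that M(1) unfolding A_def by blast+
  have "measure fair_coin A = 1"
    unfolding A_def using M prob_compl by (simp add: measure_def)
  moreover have "\<exists>Y \<subseteq> X. infinite Y \<and> (\<forall>Z. char_seq Z \<in> A \<longrightarrow> \<not> turing_reducible Z Y)"
    if X: "char_seq X \<in> A" for X
  proof -
    obtain N where N: "\<And>n s. N \<le> n \<Longrightarrow> s \<in> nodes C n \<Longrightarrow> \<exists>c\<in>C s. c \<in> X"
      using A_meets[OF X] by (auto simp: char_seq_def)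
    \<comment> \<open>Choose an element of \<open>X\<close> where possible and any element of
      \<open>C s\<close> otherwise. The default keeps \<open>x\<close> a branch from the root even
      at the levels below \<open>N\<close>, where \<open>X\<close> may miss
      \<open>C s\<close>.\<close>
    have "\<forall>s. \<exists>c\<in>C s. (\<exists>c\<in>C s. c \<in> X) \<longrightarrow> c \<in> X" using C_ne by blast
    then obtain g where g: "\<And>s. g s \<in> C s" "\<And>s. \<exists>c\<in>C s. c \<in> X \<Longrightarrow> g s \<in> X" by metis
    define l where "l = rec_nat [] (\<lambda>_ s. s @ [g s])"
    define x where "x n = g (l n)" for n
    have l: "initial x n = l n" for n by (induction n) (auto simp: initial_Suc l_def x_def)
    have x_C: "x n \<in> C (initial x n)" for n using g by (simp add: l x_def)
    then have nodes: "initial x n \<in> nodes C n" for n by (rule initial_in_nodes)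
    have x_X: "x n \<in> X" if "N \<le> n" for n using N[OF that nodes] g(2) by (simp add: l x_def)
    have x_ge: "n \<le> x n" for n using x_C C(3) T(2) by fastforce
    \<comment> \<open>Dropping the values below level \<open>N\<close>, which may lie outside
      \<open>X\<close>, makes \<open>Y\<close> a subset of \<open>X\<close>.\<close>
    define Y where "Y = tail_range N x"
    have "Y \<subseteq> X" unfolding Y_def tail_range_def using x_X by auto
    moreover have "infinite Y"
      unfolding infinite_nat_iff_unbounded_le
    proof
      fix n
      have "x (max n N) \<in> Y"
        unfolding Y_def tail_range_def using x_ge by (auto intro!: exI[of _ "max n N"])
      then show "\<exists>y\<ge>n. y \<in> Y" using x_ge[of "max n N"] by auto
    qed
    moreover have "\<not> turing_reducible Z Y" if Z: "char_seq Z \<in> A" for Z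
    proof
      assume "turing_reducible Z Y"
      then obtain p where p: "\<And>m. computes Y p [m] (of_bool (m \<in> Z))"
        unfolding turing_reducible_def by blast
      \<comment> \<open>For \<open>m\<close> outside \<open>Z\<close> the program outputs 0, and
        determinism excludes the output 1. Membership in \<open>Z\<close> thus becomes the open
        condition that the tree decides.\<close>
      have bit: "m \<in> Z \<longleftrightarrow> computes Y p [m] 1" for m
        using p[of m] computes_deterministic[OF p[of m], of 1] by (cases "m \<in> Z") auto
      have "char_seq Z \<in> B p N n" if n: "to_nat p \<le> n" "N \<le> n" for n
      proof -
        have "m \<in> Z \<longleftrightarrow> v p N (initial x n) m" if "m < width n + n" for m
        proof -
          have "branch_from n T x" using x_C C(3) by (auto simp: branch_from_def)
          then show ?thesis
            using T(3)[OF n that] bit[of m] unfolding decides_level_def v_def forces_def Y_def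
            by (metis length_initial)
        qed
        then show ?thesis using nodes unfolding B_def char_seq_def by auto
      qed
      then have "char_seq Z \<in> H p N" by (auto simp: H_def)
      then show False using A_notin[OF Z] by blast
    qed
    ultimately show ?thesis by blast
  qed
  moreover have "A \<in> sets fair_coin" unfolding A_def using M(3) by (rule sets.compl_sets)
  ultimately show ?thesis by blast
qed

end
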